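(* For all $\phi,\chi\in\mathcal{L}_\blacktriangle$: if the sequent $\phi\vdash\chi$ is valid, then it is provable in $\mathbb{S}(\mathbf{K}^\blacktriangle_\mathbf{FDE})$, i.e., there is a closed tree whose initial node is $\{w_0:\phi;\mathfrak{t},\ w_0:\chi;\overline{\mathfrak{t}}\}$.
   Context: Semantics. Formulas of $\mathcal{L}_\blacktriangle$: $\phi::=p\mid\neg\phi\mid\phi\wedge\phi\mid\phi\vee\phi\mid\blacktriangle\phi$, $p$ in a countable set $\mathsf{Var}$. A frame is $\langle W,R\rangle$, $W\neq\varnothing$, $R\subseteq W^2$; a model is $\langle W,R,v^+,v^-\rangle$ with independent $v^+,v^-:\mathsf{Var}\to 2^W$. $w\vDash^+p$ iff $w\in v^+(p)$; $w\vDash^-p$ iff $w\in v^-(p)$; $\neg$ swaps $\vDash^+$ and $\vDash^-$; $\wedge$: true iff both true, false iff some false; $\vee$: true iff some true, false iff both false. $w_0\vDash^+\blacktriangle\phi$ iff for all $R$-successors $w_1,w_2$ of $w_0$, ($w_1\vDash^+\phi\Rightarrow w_2\vDash^+\phi$) and ($w_1\vDash^-\phi\Rightarrow w_2\vDash^-\phi$), and every $R$-successor $w_1$ has $w_1\vDash^+\phi$ or $w_1\vDash^-\phi$. $w_0\vDash^-\blacktriangle\phi$ iff there are successors $w_1,w_2$ of $w_0$ with ($w_1\vDash^+\phi$, $w_2\nvDash^+\phi$) or ($w_1\vDash^-\phi$, $w_2\nvDash^-\phi$) or ($w_1\vDash^+\phi$, $w_2\vDash^-\phi$). $\phi\vdash\chi$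 is valid iff in every model at every state, $\vDash^+\phi$ implies $\vDash^+\chi$. Calculus. Fix a countable set of state-labels and value-labels $\{\mathfrak{t},\mathfrak{f},\overline{\mathfrak{t}},\overline{\mathfrak{f}}\}$ (read: true, false, not-true, not-false). A labelled formula is $w:\phi;\mathfrak{v}$. Conventions: $\overline{\overline{\mathfrak{t}}}=\mathfrak{t}$, $\overline{\overline{\mathfrak{f}}}=\mathfrak{f}$; $\mathfrak{t}^\neg=\mathfrak{f}$, $\mathfrak{f}^\neg=\mathfrak{t}$, $\overline{\mathfrak{t}}^\neg=\overline{\mathfrak{f}}$, $\overline{\mathfrak{f}}^\neg=\overline{\mathfrak{t}}$; $w:\phi;\mathfrak{v}_1;\mathfrak{v}_2$ abbreviates $w:\phi;\mathfrak{v}_1$ and $w:\phi;\mathfrak{v}_2$. A proof is a downward-branching tree whose nodes are sets of labelled formulas and relational atoms $w\mathsf{R}w'$; a branch may be extended by the rules below (premises before $\Rightarrow$; $\{i,j\}=\{1,2\}$; $w_k,w_{k_1},w_{k_2}$ fresh on the branch): $\neg$: $w:\neg\phi;\mathfrak{t}\Rightarrow w:\phi;\mathfrak{f}$; $w:\neg\phi;\mathfrak{f}\Rightarrow w:\phi;\mathfrak{t}$; $w:\neg\phi;\overline{\mathfrak{t}}\Rightarrow w:\phi;\overline{\mathfrak{f}}$; $w:\neg\phi;\overline{\mathfrak{f}}\Rightarrow w:\phi;\overline{\mathfrak{t}}$. $\wedge$: $w:\phi_1\wedge\phi_2;\mathfrak{t}\Rightarrow w:\phi_1;\mathfrak{t}$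 and $w:\phi_2;\mathfrak{t}$; $w:\phi_1\wedge\phi_2;\mathfrak{f}$, $w:\phi_i;\overline{\mathfrak{f}}\Rightarrow w:\phi_j;\mathfrak{f}$; $w:\phi_1\wedge\phi_2;\overline{\mathfrak{t}}$, $w:\phi_i;\mathfrak{t}\Rightarrow w:\phi_j;\overline{\mathfrak{t}}$; $w:\phi_1\wedge\phi_2;\overline{\mathfrak{f}}\Rightarrow w:\phi_1;\overline{\mathfrak{f}}$ and $w:\phi_2;\overline{\mathfrak{f}}$. $\vee$: $w:\phi_1\vee\phi_2;\mathfrak{t}$, $w:\phi_i;\overline{\mathfrak{t}}\Rightarrow w:\phi_j;\mathfrak{t}$; $w:\phi_1\vee\phi_2;\mathfrak{f}\Rightarrow w:\phi_1;\mathfrak{f}$ and $w:\phi_2;\mathfrak{f}$; $w:\phi_1\vee\phi_2;\overline{\mathfrak{t}}\Rightarrow w:\phi_1;\overline{\mathfrak{t}}$ and $w:\phi_2;\overline{\mathfrak{t}}$; $w:\phi_1\vee\phi_2;\overline{\mathfrak{f}}$, $w:\phi_i;\mathfrak{f}\Rightarrow w:\phi_j;\overline{\mathfrak{f}}$. Cut: with no premises, split the branch into $w:\phi;\mathfrak{v}\mid w:\phi;\overline{\mathfrak{v}}$, provided $\phi$ is a subformula of a formula on the branch and $w$ occurs on the branch. $\blacktriangle_T$: $w_i:\blacktriangle\phi;\mathfrak{t};\overline{\mathfrak{f}}$, $w_i\mathsf{R}w_j$, $w_j:\phi;\mathfrak{v}\Rightarrow w_j:\phi;\overline{\mathfrak{v}}^\neg$.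 $\blacktriangle'_T$: $w_i:\blacktriangle\phi;\mathfrak{t};\overline{\mathfrak{f}}$, $w_i\mathsf{R}w_{j_1}$, $w_i\mathsf{R}w_{j_2}$, $w_{j_1}:\phi;\mathfrak{v};\overline{\mathfrak{v}}^\neg\Rightarrow w_{j_2}:\phi;\mathfrak{v};\overline{\mathfrak{v}}^\neg$. $\blacktriangle_F$: $w_i:\blacktriangle\phi;\mathfrak{f};\overline{\mathfrak{t}}\Rightarrow$ add $w_i\mathsf{R}w_{k_1}$, $w_i\mathsf{R}w_{k_2}$, then split into $\{w_{k_1}:\phi;\mathfrak{t},\ w_{k_2}:\phi;\overline{\mathfrak{t}}\}\mid\{w_{k_1}:\phi;\mathfrak{f},\ w_{k_2}:\phi;\overline{\mathfrak{f}}\}$. $\blacktriangle_B$: $w_i:\blacktriangle\phi;\mathfrak{t};\mathfrak{f}$, $w_i\mathsf{R}w_j\Rightarrow w_j:\phi;\mathfrak{t};\mathfrak{f}$. $\blacktriangle^+_B$: $w_i:\blacktriangle\phi;\mathfrak{t};\mathfrak{f}\Rightarrow w_i\mathsf{R}w_k$, $w_k:\phi;\mathfrak{t};\mathfrak{f}$. $\blacktriangle_N$: $w_i:\blacktriangle\phi;\overline{\mathfrak{t}};\overline{\mathfrak{f}}$, $w_i\mathsf{R}w_j\Rightarrow w_j:\phi;\overline{\mathfrak{t}};\overline{\mathfrak{f}}$. $\blacktriangle^+_N$: $w_i:\blacktriangle\phi;\overline{\mathfrak{t}};\overline{\mathfrak{f}}\Rightarrow w_i\mathsf{R}w_k$,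 $w_k:\phi;\overline{\mathfrak{t}};\overline{\mathfrak{f}}$. A branch is closed iff it contains $w:\phi;\mathfrak{v}$ and $w:\phi;\overline{\mathfrak{v}}$ for some $w,\phi,\mathfrak{v}$; a tree is closed iff all its branches are closed. *)

theory Defs
  imports "HOL-Library.Countable" "HOL-Library.Infinite_Typeclass"
begin

datatype 'p fm =
    Var 'p
  | Neg "'p fm"
  | Conj "'p fm" "'p fm"
  | Disj "'p fm" "'p fm"
  | Tri "'p fm"  (* the black triangle *)

record ('w, 'p) model =
  worlds :: "'w set"
  rel :: "('w \<times> 'w) set"
  vpos :: "'p \<Rightarrow> 'w set"
  vneg :: "'p \<Rightarrow> 'w set"

definition is_model :: "('w, 'p) model \<Rightarrow> bool" where
  "is_model M \<longleftrightarrow> worlds M \<noteq> {} \<and> rel M \<subseteq> worlds M \<times> worlds M \<and>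
     (\<forall>p. vpos M p \<subseteq> worlds M) \<and> (\<forall>p. vneg M p \<subseteq> worlds M)"

fun sat_pos :: "('w, 'p) model \<Rightarrow> 'w \<Rightarrow> 'p fm \<Rightarrow> bool"
  and sat_neg :: "('w, 'p) model \<Rightarrow> 'w \<Rightarrow> 'p fm \<Rightarrow> bool" where
  "sat_pos M w (Var p) \<longleftrightarrow> w \<in> vpos M p"
| "sat_pos M w (Neg \<phi>) \<longleftrightarrow> sat_neg M w \<phi>"
| "sat_pos M w (Conj \<phi> \<psi>) \<longleftrightarrow> sat_pos M w \<phi> \<and> sat_pos M w \<psi>"
| "sat_pos M w (Disj \<phi> \<psi>) \<longleftrightarrow> sat_pos M w \<phi> \<or> sat_pos M w \<psi>"
| "sat_pos M w (Tri \<phi>) \<longleftrightarrow>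
     (\<forall>w1 w2. (w, w1) \<in> rel M \<longrightarrow> (w, w2) \<in> rel M \<longrightarrow>
        (sat_pos M w1 \<phi> \<longrightarrow> sat_pos M w2 \<phi>) \<and> (sat_neg M w1 \<phi> \<longrightarrow> sat_neg M w2 \<phi>)) \<and>
     (\<forall>w1. (w, w1) \<in> rel M \<longrightarrow> sat_pos M w1 \<phi> \<or> sat_neg M w1 \<phi>)"
| "sat_neg M w (Var p) \<longleftrightarrow> w \<in> vneg M p"
| "sat_neg M w (Neg \<phi>) \<longleftrightarrow> sat_pos M w \<phi>"
| "sat_neg M w (Conj \<phi> \<psi>) \<longleftrightarrow> sat_neg M w \<phi> \<or> sat_neg M w \<psi>"
| "sat_neg M w (Disj \<phi> \<psi>) \<longleftrightarrow> sat_neg M w \<phi> \<and> sat_neg M w \<psi>"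
| "sat_neg M w (Tri \<phi>) \<longleftrightarrow>
     (\<exists>w1 w2. (w, w1) \<in> rel M \<and> (w, w2) \<in> rel M \<and>
        ((sat_pos M w1 \<phi> \<and> \<not> sat_pos M w2 \<phi>) \<or>
         (sat_neg M w1 \<phi> \<and> \<not> sat_neg M w2 \<phi>) \<or>
         (sat_pos M w1 \<phi> \<and> sat_neg M w2 \<phi>)))"

(* HOL cannot quantify over types inside a formula, so validity takes the type
   from which the carriers of models are drawn as a parameter. *)
definition valid :: "'w itself \<Rightarrow> 'p fm \<Rightarrow> 'p fm \<Rightarrow> bool" where
  "valid _ \<phi> \<chi> \<longleftrightarrow>
     (\<forall>M :: ('w, 'p) model. is_model M \<longrightarrow>
        (\<forall>w \<in> worlds M. sat_pos M w \<phi> \<longrightarrow> sat_pos M w \<chi>))"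

(* true, false, not-true, not-false *)
datatype val = VT | VF | VNT | VNF

fun bar :: "val \<Rightarrow> val" where
  "bar VT = VNT"
| "bar VF = VNF"
| "bar VNT = VT"
| "bar VNF = VF"

fun neg_val :: "val \<Rightarrow> val" where
  "neg_val VT = VF"
| "neg_val VF = VT"
| "neg_val VNT = VNF"
| "neg_val VNF = VNT"

type_synonym label = nat

datatype 'p item = Lab label "'p fm" val | Rel label label

fun item_labels :: "'p item \<Rightarrow> label set" where
  "item_labels (Lab w \<phi> v) = {w}"
| "item_labels (Rel w w') = {w, w'}"

definition labels :: "'p item set \<Rightarrow> label set" where
  "labels B = (\<Union>x \<in> B. item_labels x)"

fun subfms :: "'p fm \<Rightarrow> 'p fm set" where
  "subfms (Var p) = {Var p}"
| "subfms (Neg \<phi>) = insert (Neg \<phi>) (subfms \<phi>)"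
| "subfms (Conj \<phi> \<psi>) = insert (Conj \<phi> \<psi>) (subfms \<phi> \<union> subfms \<psi>)"
| "subfms (Disj \<phi> \<psi>) = insert (Disj \<phi> \<psi>) (subfms \<phi> \<union> subfms \<psi>)"
| "subfms (Tri \<phi>) = insert (Tri \<phi>) (subfms \<phi>)"

(* rule_app B Ns: some rule is applicable to the branch B (the set of everything occurring
   on it), and Ns lists the nodes it appends, one for each branch that results. *)
inductive rule_app :: "'p item set \<Rightarrow> 'p item set list \<Rightarrow> bool" where
  neg_t: "Lab w (Neg \<phi>) VT \<in> B \<Longrightarrow> rule_app B [{Lab w \<phi> VF}]"
| neg_f: "Lab w (Neg \<phi>) VF \<in> B \<Longrightarrow> rule_app B [{Lab w \<phi> VT}]"
| neg_nt: "Lab w (Neg \<phi>) VNT \<in> B \<Longrightarrow> rule_app B [{Lab w \<phi> VNF}]"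
| neg_nf: "Lab w (Neg \<phi>) VNF \<in> B \<Longrightarrow> rule_app B [{Lab w \<phi> VNT}]"

| conj_t: "Lab w (Conj \<phi>1 \<phi>2) VT \<in> B \<Longrightarrow> rule_app B [{Lab w \<phi>1 VT, Lab w \<phi>2 VT}]"
| conj_f1: "Lab w (Conj \<phi>1 \<phi>2) VF \<in> B \<Longrightarrow> Lab w \<phi>1 VNF \<in> B \<Longrightarrow> rule_app B [{Lab w \<phi>2 VF}]"
| conj_f2: "Lab w (Conj \<phi>1 \<phi>2) VF \<in> B \<Longrightarrow> Lab w \<phi>2 VNF \<in> B \<Longrightarrow> rule_app B [{Lab w \<phi>1 VF}]"
| conj_nt1: "Lab w (Conj \<phi>1 \<phi>2) VNT \<in> B \<Longrightarrow> Lab w \<phi>1 VT \<in> B \<Longrightarrow> rule_app B [{Lab w \<phi>2 VNT}]"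
| conj_nt2: "Lab w (Conj \<phi>1 \<phi>2) VNT \<in> B \<Longrightarrow> Lab w \<phi>2 VT \<in> B \<Longrightarrow> rule_app B [{Lab w \<phi>1 VNT}]"
| conj_nf: "Lab w (Conj \<phi>1 \<phi>2) VNF \<in> B \<Longrightarrow> rule_app B [{Lab w \<phi>1 VNF, Lab w \<phi>2 VNF}]"

| disj_t1: "Lab w (Disj \<phi>1 \<phi>2) VT \<in> B \<Longrightarrow> Lab w \<phi>1 VNT \<in> B \<Longrightarrow> rule_app B [{Lab w \<phi>2 VT}]"
| disj_t2: "Lab w (Disj \<phi>1 \<phi>2) VT \<in> B \<Longrightarrow> Lab w \<phi>2 VNT \<in> B \<Longrightarrow> rule_app B [{Lab w \<phi>1 VT}]"
| disj_f: "Lab w (Disj \<phi>1 \<phi>2) VF \<in> B \<Longrightarrow> rule_app B [{Lab w \<phi>1 VF, Lab w \<phi>2 VF}]"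
| disj_nt: "Lab w (Disj \<phi>1 \<phi>2) VNT \<in> B \<Longrightarrow> rule_app B [{Lab w \<phi>1 VNT, Lab w \<phi>2 VNT}]"
| disj_nf1: "Lab w (Disj \<phi>1 \<phi>2) VNF \<in> B \<Longrightarrow> Lab w \<phi>1 VF \<in> B \<Longrightarrow> rule_app B [{Lab w \<phi>2 VNF}]"
| disj_nf2: "Lab w (Disj \<phi>1 \<phi>2) VNF \<in> B \<Longrightarrow> Lab w \<phi>2 VF \<in> B \<Longrightarrow> rule_app B [{Lab w \<phi>1 VNF}]"

| cut: "Lab u \<psi> v' \<in> B \<Longrightarrow> \<phi> \<in> subfms \<psi> \<Longrightarrow> w \<in> labels B \<Longrightarrow>
    rule_app B [{Lab w \<phi> v}, {Lab w \<phi> (bar v)}]"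

| tri_T: "Lab wi (Tri \<phi>) VT \<in> B \<Longrightarrow> Lab wi (Tri \<phi>) VNF \<in> B \<Longrightarrow> Rel wi wj \<in> B \<Longrightarrow>
    Lab wj \<phi> v \<in> B \<Longrightarrow>
    rule_app B [{Lab wj \<phi> (neg_val (bar v))}]"
| tri_T': "Lab wi (Tri \<phi>) VT \<in> B \<Longrightarrow> Lab wi (Tri \<phi>) VNF \<in> B \<Longrightarrow>
    Rel wi wj1 \<in> B \<Longrightarrow> Rel wi wj2 \<in> B \<Longrightarrow>
    Lab wj1 \<phi> v \<in> B \<Longrightarrow> Lab wj1 \<phi> (neg_val (bar v)) \<in> B \<Longrightarrow>
    rule_app B [{Lab wj2 \<phi> v, Lab wj2 \<phi> (neg_val (bar v))}]"
| tri_F: "Lab wi (Tri \<phi>) VF \<in> B \<Longrightarrow> Lab wi (Tri \<phi>) VNT \<in> B \<Longrightarrow>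
    wk1 \<notin> labels B \<Longrightarrow> wk2 \<notin> labels B \<Longrightarrow> wk1 \<noteq> wk2 \<Longrightarrow>
    rule_app B
      [{Rel wi wk1, Rel wi wk2, Lab wk1 \<phi> VT, Lab wk2 \<phi> VNT},
       {Rel wi wk1, Rel wi wk2, Lab wk1 \<phi> VF, Lab wk2 \<phi> VNF}]"
| tri_B: "Lab wi (Tri \<phi>) VT \<in> B \<Longrightarrow> Lab wi (Tri \<phi>) VF \<in> B \<Longrightarrow> Rel wi wj \<in> B \<Longrightarrow>
    rule_app B [{Lab wj \<phi> VT, Lab wj \<phi> VF}]"
| tri_B_plus: "Lab wi (Tri \<phi>) VT \<in> B \<Longrightarrow> Lab wi (Tri \<phi>) VF \<in> B \<Longrightarrow> wk \<notin> labels B \<Longrightarrow>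
    rule_app B [{Rel wi wk, Lab wk \<phi> VT, Lab wk \<phi> VF}]"
| tri_N: "Lab wi (Tri \<phi>) VNT \<in> B \<Longrightarrow> Lab wi (Tri \<phi>) VNF \<in> B \<Longrightarrow> Rel wi wj \<in> B \<Longrightarrow>
    rule_app B [{Lab wj \<phi> VNT, Lab wj \<phi> VNF}]"
| tri_N_plus: "Lab wi (Tri \<phi>) VNT \<in> B \<Longrightarrow> Lab wi (Tri \<phi>) VNF \<in> B \<Longrightarrow> wk \<notin> labels B \<Longrightarrow>
    rule_app B [{Rel wi wk, Lab wk \<phi> VNT, Lab wk \<phi> VNF}]"

datatype 'p tree = Node (root: "'p item set") "'p tree list"

(* proof_tree A t: t grows according to the rules below a path whose nodes have union A. *)
inductive proof_tree :: "'p item set \<Rightarrow> 'p tree \<Rightarrow> bool" where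
  leaf: "proof_tree A (Node N [])"
| extend: "rule_app (A \<union> N) (map root ts) \<Longrightarrow> (\<And>t. t \<in> set ts \<Longrightarrow> proof_tree (A \<union> N) t) \<Longrightarrow>
    proof_tree A (Node N ts)"

(* Each maximal path is represented by the union of its nodes. *)
fun branches :: "'p tree \<Rightarrow> 'p item set set" where
  "branches (Node N ts) =
     (if ts = [] then {N} else (\<Union>t \<in> set ts. (\<lambda>B. N \<union> B) ` branches t))"

definition closed_branch :: "'p item set \<Rightarrow> bool" where
  "closed_branch B \<longleftrightarrow> (\<exists>w \<phi> v. Lab w \<phi> v \<in> B \<and> Lab w \<phi> (bar v) \<in> B)"

definition closed_tree :: "'p tree \<Rightarrow> bool" where
  "closed_tree t \<longleftrightarrow> (\<forall>B \<in> branches t. closed_branch B)"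

definition provable :: "'p fm \<Rightarrow> 'p fm \<Rightarrow> bool" where
  "provable \<phi> \<chi> \<longleftrightarrow>
     (\<exists>t. root t = {Lab 0 \<phi> VT, Lab 0 \<chi> VNT} \<and> proof_tree {} t \<and> closed_tree t)"

end

theory Submission
  imports Defs
begin

text \<open>
  If the initial node has no closed tree, the branch can be extended forever without becoming
  refutable, deciding by cut every subformula at every label and adding witnesses for the three
  rules that create labels. No other rule needs to be scheduled: on the resulting union \<open>H\<close>, a
  missing conclusion would be contradicted by the opposite value chosen by cut, so some finite part
  of \<open>H\<close> would be refutable in one step. Reading relations and values off \<open>H\<close> yields a countermodel
  on the labels, which embeds into any infinite type.
\<close>

section \<open>Refutable branches and closed trees\<close>

text \<open>Captures the existence of a closed tree through the content of the current branch alone,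
  so that no tree has to be handled later. The condition \<open>Ns \<noteq> []\<close> matches the
  trees: a node without children is a leaf, whose branch must itself be closed.\<close>

inductive refutable :: "'p item set \<Rightarrow> bool" where
  closed: "closed_branch B \<Longrightarrow> refutable B"
| rule: "rule_app B Ns \<Longrightarrow> Ns \<noteq> [] \<Longrightarrow> (\<And>N. N \<in> set Ns \<Longrightarrow> refutable (B \<union> N)) \<Longrightarrow> refutable B"

text \<open>Refutability sees only the union of the nodes on a path, whereas
  \<open>proof_tree\<close> separates the last node \<open>N\<close> from the part \<open>A\<close>
  above it; the induction therefore ranges over all splittings. Closure is claimed for
  \<open>A \<union> C\<close> because \<open>branches t\<close> leaves out what lies above the
  root.\<close>

lemma refutable_imp_closed_tree:
  assumes "refutable B" and "B = A \<union> N"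
  shows "\<exists>t. root t = N \<and> proof_tree A t \<and> (\<forall>C \<in> branches t. closed_branch (A \<union> C))"
  using assms
proof (induction arbitrary: A N rule: refutable.induct)
  case (closed B)
  then show ?case
    by (intro exI[of _ "Node N []"]) (auto intro: proof_tree.leaf)
next
  case (rule B Ns)
  have "\<forall>M \<in> set Ns. \<exists>t. root t = M \<and> proof_tree B t \<and>
      (\<forall>C \<in> branches t. closed_branch (B \<union> C))"
    using rule.IH by blast
  then obtain f where f: "\<And>M. M \<in> set Ns \<Longrightarrow> root (f M) = M \<and> proof_tree B (f M) \<and>
      (\<forall>C \<in> branches (f M). closed_branch (B \<union> C))"
    by metis
  have roots: "map root (map f Ns) = Ns"
    using f by (simp add: map_idI)
  have "proof_tree A (Node N (map f Ns))"
  proof (rule proof_tree.extend)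
    show "rule_app (A \<union> N) (map root (map f Ns))"
      using rule.hyps(1) rule.prems roots by simp
    show "proof_tree (A \<union> N) t" if "t \<in> set (map f Ns)" for t
      using that f rule.prems by auto
  qed
  moreover have "closed_branch (A \<union> C)" if "C \<in> branches (Node N (map f Ns))" for C
    using that f rule.hyps(2) rule.prems by (auto simp: Un_assoc)
  ultimately show ?case
    by (intro exI[of _ "Node N (map f Ns)"]) auto
qed

lemma refutable_imp_provable:
  assumes "refutable {Lab 0 \<phi> VT, Lab 0 \<chi> VNT}"
  shows "provable \<phi> \<chi>"
  using refutable_imp_closed_tree[OF assms, of "{}"]
  unfolding provable_def closed_tree_def by auto

lemma bar_bar [simp]: "bar (bar v) = v"
  by (cases v) auto

lemma refutable_if_clash: "Lab w \<phi> v \<in> B \<Longrightarrow> Lab w \<phi> (bar v) \<in> B \<Longrightarrow> refutable B"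
  by (rule refutable.closed) (auto simp: closed_branch_def)

lemma subfms_refl [simp]: "\<phi> \<in> subfms \<phi>"
  by (cases \<phi>) auto

lemma subfms_trans: "\<phi> \<in> subfms \<psi> \<Longrightarrow> subfms \<phi> \<subseteq> subfms \<psi>"
  by (induction \<psi>) auto

lemma labels_mono: "A \<subseteq> B \<Longrightarrow> labels A \<subseteq> labels B"
  unfolding labels_def by blast

lemma labels_RelD: "Rel w w' \<in> B \<Longrightarrow> w \<in> labels B \<and> w' \<in> labels B"
  unfolding labels_def by force

lemma labels_LabD: "Lab w \<phi> v \<in> B \<Longrightarrow> w \<in> labels B"
  unfolding labels_def by force

lemma finite_labels: "finite B \<Longrightarrow> finite (labels B)"
  unfolding labels_def
proof (rule finite_UN_I)
  show "finite (item_labels x)" for x :: "'a item"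
    by (cases x) auto
qed

section \<open>Hintikka sets and the truth lemma\<close>

text \<open>\<open>H\<close> may be infinite and leave no label fresh, so consistency is stated
  through irrefutable sets between a finite part and \<open>H\<close>. Asking for such a set, and
  not for irrefutability of \<open>P\<close> itself, avoids a weakening argument, which the
  freshness conditions would complicate. \<open>S\<close> collects the formulas on which cut has
  been performed.\<close>

locale hintikka =
  fixes H :: "'p item set" and S :: "'p fm set"
  assumes approx: "finite P \<Longrightarrow> P \<subseteq> H \<Longrightarrow> \<exists>B. P \<subseteq> B \<and> B \<subseteq> H \<and> \<not> refutable B"
    and subfms_closed: "\<phi> \<in> S \<Longrightarrow> subfms \<phi> \<subseteq> S"
    and decided: "w \<in> labels H \<Longrightarrow> \<phi> \<in> S \<Longrightarrow> Lab w \<phi> v \<in> H \<or> Lab w \<phi> (bar v) \<in> H"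
    and witness_F: "Tri \<phi> \<in> S \<Longrightarrow> Lab w (Tri \<phi>) VF \<in> H \<Longrightarrow> Lab w (Tri \<phi>) VNT \<in> H \<Longrightarrow>
      \<exists>k l. Rel w k \<in> H \<and> Rel w l \<in> H \<and>
        (Lab k \<phi> VT \<in> H \<and> Lab l \<phi> VNT \<in> H \<or> Lab k \<phi> VF \<in> H \<and> Lab l \<phi> VNF \<in> H)"
    and witness_B: "Tri \<phi> \<in> S \<Longrightarrow> Lab w (Tri \<phi>) VT \<in> H \<Longrightarrow> Lab w (Tri \<phi>) VF \<in> H \<Longrightarrow>
      \<exists>k. Rel w k \<in> H \<and> Lab k \<phi> VT \<in> H \<and> Lab k \<phi> VF \<in> H"
    and witness_N: "Tri \<phi> \<in> S \<Longrightarrow> Lab w (Tri \<phi>) VNT \<in> H \<Longrightarrow> Lab w (Tri \<phi>) VNF \<in> H \<Longrightarrow>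
      \<exists>k. Rel w k \<in> H \<and> Lab k \<phi> VNT \<in> H \<and> Lab k \<phi> VNF \<in> H"
begin

lemma no_clash: "Lab w \<phi> v \<in> H \<Longrightarrow> Lab w \<phi> (bar v) \<notin> H"
  using approx[of "{Lab w \<phi> v, Lab w \<phi> (bar v)}"] refutable_if_clash[of w \<phi> v] by auto

text \<open>Cut supplies one of the two values and consistency excludes the other, so the barred
  values become plain complements.\<close>

lemma VNT_iff: "w \<in> labels H \<Longrightarrow> \<phi> \<in> S \<Longrightarrow> Lab w \<phi> VNT \<in> H \<longleftrightarrow> Lab w \<phi> VT \<notin> H"
  using decided[of w \<phi> VT] no_clash[of w \<phi> VT] by auto

lemma VNF_iff: "w \<in> labels H \<Longrightarrow> \<phi> \<in> S \<Longrightarrow> Lab w \<phi> VNF \<in> H \<longleftrightarrow> Lab w \<phi> VF \<notin> H"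
  using decided[of w \<phi> VF] no_clash[of w \<phi> VF] by auto

text \<open>If the conclusion were missing, \<open>H\<close> would contain the opposite value. An
  irrefutable \<open>B\<close> containing that value and the premises would then close after one
  application of the rule. The rule must apply to every superset of \<open>P\<close>, since
  \<open>approx\<close> gives no control over \<open>B\<close>; this holds for the rules with one
  result and no fresh label.\<close>

lemma forced:
  assumes "finite P" and "P \<subseteq> H" and "\<And>B. P \<subseteq> B \<Longrightarrow> rule_app B [N]"
    and "w \<in> labels H" and "\<phi> \<in> S" and "Lab w \<phi> v \<in> N"
  shows "Lab w \<phi> v \<in> H"
proof (rule ccontr)
  assume "Lab w \<phi> v \<notin> H"
  then have "Lab w \<phi> (bar v) \<in> H"
    using decided assms(4,5) by blast
  then obtain B where B: "insert (Lab w \<phi> (bar v)) P \<subseteq> B" "\<not> refutable B"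
    using approx[of "insert (Lab w \<phi> (bar v)) P"] assms(1,2) by auto
  have "refutable (B \<union> N)"
    using refutable_if_clash[of w \<phi> v "B \<union> N"] assms(6) B(1) by auto
  then have "refutable B"
    using refutable.rule[OF assms(3)] B(1) by auto
  with B(2) show False ..
qed

text \<open>The rules for \<open>VT\<close> and \<open>VF\<close> give the forward directions. Those
  for \<open>VNT\<close> and \<open>VNF\<close> give the converses by contraposition, as barred
  values are complements.\<close>

lemma Neg_iff:
  assumes "w \<in> labels H" and "Neg \<phi> \<in> S"
  shows "Lab w (Neg \<phi>) VT \<in> H \<longleftrightarrow> Lab w \<phi> VF \<in> H"
    and "Lab w (Neg \<phi>) VF \<in> H \<longleftrightarrow> Lab w \<phi> VT \<in> H"
proof -
  have S: "\<phi> \<in> S"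
    using subfms_closed[OF assms(2)] by auto
  have "Lab w \<phi> VF \<in> H" if "Lab w (Neg \<phi>) VT \<in> H"
    by (rule forced[of "{Lab w (Neg \<phi>) VT}" "{Lab w \<phi> VF}"])
      (use that assms S in \<open>auto intro: rule_app.neg_t\<close>)
  moreover have "Lab w \<phi> VT \<in> H" if "Lab w (Neg \<phi>) VF \<in> H"
    by (rule forced[of "{Lab w (Neg \<phi>) VF}" "{Lab w \<phi> VT}"])
      (use that assms S in \<open>auto intro: rule_app.neg_f\<close>)
  moreover have "Lab w \<phi> VNF \<in> H" if "Lab w (Neg \<phi>) VNT \<in> H"
    by (rule forced[of "{Lab w (Neg \<phi>) VNT}" "{Lab w \<phi> VNF}"])
      (use that assms S in \<open>auto intro: rule_app.neg_nt\<close>)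
  moreover have "Lab w \<phi> VNT \<in> H" if "Lab w (Neg \<phi>) VNF \<in> H"
    by (rule forced[of "{Lab w (Neg \<phi>) VNF}" "{Lab w \<phi> VNT}"])
      (use that assms S in \<open>auto intro: rule_app.neg_nf\<close>)
  ultimately show "Lab w (Neg \<phi>) VT \<in> H \<longleftrightarrow> Lab w \<phi> VF \<in> H"
    and "Lab w (Neg \<phi>) VF \<in> H \<longleftrightarrow> Lab w \<phi> VT \<in> H"
    using assms S VNT_iff VNF_iff by blast+
qed

lemma Conj_iff:
  assumes "w \<in> labels H" and "Conj \<phi> \<psi> \<in> S"
  shows "Lab w (Conj \<phi> \<psi>) VT \<in> H \<longleftrightarrow> Lab w \<phi> VT \<in> H \<and> Lab w \<psi> VT \<in> H"
    and "Lab w (Conj \<phi> \<psi>) VF \<in> H \<longleftrightarrow> Lab w \<phi> VF \<in> H \<or> Lab w \<psi> VF \<in> H"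
proof -
  have S: "\<phi> \<in> S" "\<psi> \<in> S"
    using subfms_closed[OF assms(2)] by auto
  have "Lab w \<phi> VT \<in> H \<and> Lab w \<psi> VT \<in> H" if "Lab w (Conj \<phi> \<psi>) VT \<in> H"
    by (intro conjI forced[of "{Lab w (Conj \<phi> \<psi>) VT}" "{Lab w \<phi> VT, Lab w \<psi> VT}"])
      (use that assms S in \<open>auto intro: rule_app.conj_t\<close>)
  \<comment> \<open>With values decided, this says that two true conjuncts make the conjunction
    true, a condition symmetric in the conjuncts. The next rule likewise says that a false
    conjunction has a false conjunct.\<close>
  moreover have "Lab w \<psi> VNT \<in> H" if "Lab w (Conj \<phi> \<psi>) VNT \<in> H" "Lab w \<phi> VT \<in> H"
    by (rule forced[of "{Lab w (Conj \<phi> \<psi>) VNT, Lab w \<phi> VT}" "{Lab w \<psi> VNT}"])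
      (use that assms S in \<open>auto intro: rule_app.conj_nt1\<close>)
  moreover have "Lab w \<psi> VF \<in> H" if "Lab w (Conj \<phi> \<psi>) VF \<in> H" "Lab w \<phi> VNF \<in> H"
    by (rule forced[of "{Lab w (Conj \<phi> \<psi>) VF, Lab w \<phi> VNF}" "{Lab w \<psi> VF}"])
      (use that assms S in \<open>auto intro: rule_app.conj_f1\<close>)
  moreover have "Lab w \<phi> VNF \<in> H \<and> Lab w \<psi> VNF \<in> H" if "Lab w (Conj \<phi> \<psi>) VNF \<in> H"
    by (intro conjI forced[of "{Lab w (Conj \<phi> \<psi>) VNF}" "{Lab w \<phi> VNF, Lab w \<psi> VNF}"])
      (use that assms S in \<open>auto intro: rule_app.conj_nf\<close>)
  ultimately show "Lab w (Conj \<phi> \<psi>) VT \<in> H \<longleftrightarrow> Lab w \<phi> VT \<in> H \<and> Lab w \<psi> VT \<in> H"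
    and "Lab w (Conj \<phi> \<psi>) VF \<in> H \<longleftrightarrow> Lab w \<phi> VF \<in> H \<or> Lab w \<psi> VF \<in> H"
    using assms S VNT_iff VNF_iff by blast+
qed

lemma Disj_iff:
  assumes "w \<in> labels H" and "Disj \<phi> \<psi> \<in> S"
  shows "Lab w (Disj \<phi> \<psi>) VT \<in> H \<longleftrightarrow> Lab w \<phi> VT \<in> H \<or> Lab w \<psi> VT \<in> H"
    and "Lab w (Disj \<phi> \<psi>) VF \<in> H \<longleftrightarrow> Lab w \<phi> VF \<in> H \<and> Lab w \<psi> VF \<in> H"
proof -
  have S: "\<phi> \<in> S" "\<psi> \<in> S"
    using subfms_closed[OF assms(2)] by auto
  have "Lab w \<psi> VT \<in> H" if "Lab w (Disj \<phi> \<psi>) VT \<in> H" "Lab w \<phi> VNT \<in> H"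
    by (rule forced[of "{Lab w (Disj \<phi> \<psi>) VT, Lab w \<phi> VNT}" "{Lab w \<psi> VT}"])
      (use that assms S in \<open>auto intro: rule_app.disj_t1\<close>)
  moreover have "Lab w \<phi> VNT \<in> H \<and> Lab w \<psi> VNT \<in> H" if "Lab w (Disj \<phi> \<psi>) VNT \<in> H"
    by (intro conjI forced[of "{Lab w (Disj \<phi> \<psi>) VNT}" "{Lab w \<phi> VNT, Lab w \<psi> VNT}"])
      (use that assms S in \<open>auto intro: rule_app.disj_nt\<close>)
  moreover have "Lab w \<phi> VF \<in> H \<and> Lab w \<psi> VF \<in> H" if "Lab w (Disj \<phi> \<psi>) VF \<in> H"
    by (intro conjI forced[of "{Lab w (Disj \<phi> \<psi>) VF}" "{Lab w \<phi> VF, Lab w \<psi> VF}"])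
      (use that assms S in \<open>auto intro: rule_app.disj_f\<close>)
  moreover have "Lab w \<psi> VNF \<in> H" if "Lab w (Disj \<phi> \<psi>) VNF \<in> H" "Lab w \<phi> VF \<in> H"
    by (rule forced[of "{Lab w (Disj \<phi> \<psi>) VNF, Lab w \<phi> VF}" "{Lab w \<psi> VNF}"])
      (use that assms S in \<open>auto intro: rule_app.disj_nf1\<close>)
  ultimately show "Lab w (Disj \<phi> \<psi>) VT \<in> H \<longleftrightarrow> Lab w \<phi> VT \<in> H \<or> Lab w \<psi> VT \<in> H"
    and "Lab w (Disj \<phi> \<psi>) VF \<in> H \<longleftrightarrow> Lab w \<phi> VF \<in> H \<and> Lab w \<psi> VF \<in> H"
    using assms S VNT_iff VNF_iff by blast+
qed

text \<open>The four combinations of \<open>VT\<close> and \<open>VF\<close> at \<open>w\<close>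
  match the four groups of triangle rules. In each group the values at the successors settle both
  semantic clauses at once.\<close>

lemma Tri_iff:
  assumes "w \<in> labels H" and "Tri \<phi> \<in> S"
  shows "Lab w (Tri \<phi>) VT \<in> H \<longleftrightarrow>
      (\<forall>k l. Rel w k \<in> H \<longrightarrow> Rel w l \<in> H \<longrightarrow>
        (Lab k \<phi> VT \<in> H \<longrightarrow> Lab l \<phi> VT \<in> H) \<and> (Lab k \<phi> VF \<in> H \<longrightarrow> Lab l \<phi> VF \<in> H)) \<and>
      (\<forall>k. Rel w k \<in> H \<longrightarrow> Lab k \<phi> VT \<in> H \<or> Lab k \<phi> VF \<in> H)" (is "?t \<longleftrightarrow> ?pos")
    and "Lab w (Tri \<phi>) VF \<in> H \<longleftrightarrow>
      (\<exists>k l. Rel w k \<in> H \<and> Rel w l \<in> H \<and>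
        (Lab k \<phi> VT \<in> H \<and> Lab l \<phi> VT \<notin> H \<or> Lab k \<phi> VF \<in> H \<and> Lab l \<phi> VF \<notin> H \<or>
         Lab k \<phi> VT \<in> H \<and> Lab l \<phi> VF \<in> H))" (is "?f \<longleftrightarrow> ?neg")
proof -
  have S: "\<phi> \<in> S"
    using subfms_closed[OF assms(2)] by auto
  note iffs = VNT_iff[OF assms] VNF_iff[OF assms]
  have succ: "k \<in> labels H" "Lab k \<phi> VNT \<in> H \<longleftrightarrow> Lab k \<phi> VT \<notin> H"
      "Lab k \<phi> VNF \<in> H \<longleftrightarrow> Lab k \<phi> VF \<notin> H" if "Rel w k \<in> H" for k
    using labels_RelD[OF that] VNT_iff VNF_iff S by blast+
  \<comment> \<open>The map \<open>neg_val (bar v)\<close> pairs \<open>VT\<close> with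
    \<open>VNF\<close> and \<open>VF\<close> with \<open>VNT\<close>: each successor gives the
    formula exactly one of truth and falsity.\<close>
  have T: "Lab k \<phi> (neg_val (bar v)) \<in> H"
    if "?t" "Lab w (Tri \<phi>) VNF \<in> H" "Rel w k \<in> H" "Lab k \<phi> v \<in> H" for k v
    by (rule forced[of "{Lab w (Tri \<phi>) VT, Lab w (Tri \<phi>) VNF, Rel w k, Lab k \<phi> v}"
          "{Lab k \<phi> (neg_val (bar v))}"])
      (use that succ S in \<open>auto intro: rule_app.tri_T\<close>)
  \<comment> \<open>The second value that the rule requires at \<open>k\<close> is supplied by
    \<open>T\<close>, so all successors agree.\<close>
  have T': "Lab l \<phi> v \<in> H"
    if "?t" "Lab w (Tri \<phi>) VNF \<in> H" "Rel w k \<in> H" "Rel w l \<in> H" "Lab k \<phi> v \<in> H" for k l v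
    by (rule forced[of "{Lab w (Tri \<phi>) VT, Lab w (Tri \<phi>) VNF, Rel w k, Rel w l, Lab k \<phi> v,
            Lab k \<phi> (neg_val (bar v))}" "{Lab l \<phi> v, Lab l \<phi> (neg_val (bar v))}"])
      (use that T succ S in \<open>auto intro: rule_app.tri_T'\<close>)
  have B: "Lab k \<phi> VT \<in> H \<and> Lab k \<phi> VF \<in> H" if "?t" "?f" "Rel w k \<in> H" for k
    by (intro conjI forced[of "{Lab w (Tri \<phi>) VT, Lab w (Tri \<phi>) VF, Rel w k}"
          "{Lab k \<phi> VT, Lab k \<phi> VF}"])
      (use that succ S in \<open>auto intro: rule_app.tri_B\<close>)
  have N: "Lab k \<phi> VNT \<in> H \<and> Lab k \<phi> VNF \<in> H"
    if "Lab w (Tri \<phi>) VNT \<in> H" "Lab w (Tri \<phi>) VNF \<in> H" "Rel w k \<in> H" for k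
    by (intro conjI forced[of "{Lab w (Tri \<phi>) VNT, Lab w (Tri \<phi>) VNF, Rel w k}"
          "{Lab k \<phi> VNT, Lab k \<phi> VNF}"])
      (use that succ S in \<open>auto intro: rule_app.tri_N\<close>)
  consider "?t" "\<not> ?f" | "?t" "?f" | "\<not> ?t" "?f" | "\<not> ?t" "\<not> ?f"
    by blast
  then have "(?t \<longleftrightarrow> ?pos) \<and> (?f \<longleftrightarrow> ?neg)"
  proof cases
    case 1
    then have nf: "Lab w (Tri \<phi>) VNF \<in> H"
      using iffs by blast
    have exact: "Lab k \<phi> VT \<in> H \<longleftrightarrow> Lab k \<phi> VF \<notin> H" if "Rel w k \<in> H" for k
      using T[OF 1(1) nf that, of VT] T[OF 1(1) nf that, of VNT] succ[OF that] by auto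
    have "Lab k \<phi> v \<in> H \<Longrightarrow> Lab l \<phi> v \<in> H" if "Rel w k \<in> H" "Rel w l \<in> H" for k l v
      using T'[OF 1(1) nf that] .
    with exact 1 show ?thesis by blast
  next
    \<comment> \<open>Every successor is both true and false, and there is one. Constancy gives the
      positive clause; taking that successor twice gives the negative one through its last
      disjunct.\<close>
    case 2
    then show ?thesis
      using B witness_B[OF assms(2)] by blast
  next
    case 3
    then obtain k l where "Rel w k \<in> H" "Rel w l \<in> H"
      "Lab k \<phi> VT \<in> H \<and> Lab l \<phi> VT \<notin> H \<or> Lab k \<phi> VF \<in> H \<and> Lab l \<phi> VF \<notin> H"
      using witness_F[OF assms(2)] iffs succ by blast
    with 3 show ?thesis by blast
  next
    \<comment> \<open>Every successor has neither value, so the negative clause has no candidate;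
      the existing successor violates the requirement that some value be present.\<close>
    case 4
    then have "Lab w (Tri \<phi>) VNT \<in> H" "Lab w (Tri \<phi>) VNF \<in> H"
      using iffs by blast+
    then show ?thesis
      using 4 N witness_N[OF assms(2)] succ by blast
  qed
  then show "?t \<longleftrightarrow> ?pos" and "?f \<longleftrightarrow> ?neg" by blast+
qed

text \<open>The canonical model on the labels, copied along \<open>e\<close> because
  \<open>valid\<close> prescribes the type of worlds.\<close>

definition term_model :: "(label \<Rightarrow> 'w) \<Rightarrow> ('w, 'p) model" where
  "term_model e = \<lparr>worlds = e ` labels H,
     rel = {(e w, e w') | w w'. Rel w w' \<in> H},
     vpos = (\<lambda>p. {e w | w. Lab w (Var p) VT \<in> H}),
     vneg = (\<lambda>p. {e w | w. Lab w (Var p) VF \<in> H})\<rparr>"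

lemma is_model_term_model: "H \<noteq> {} \<Longrightarrow> is_model (term_model e)"
proof -
  assume "H \<noteq> {}"
  then obtain x where "x \<in> H" by blast
  then have "labels H \<noteq> {}"
    unfolding labels_def by (cases x) force+
  then show ?thesis
    unfolding is_model_def term_model_def
    by (auto dest: labels_RelD labels_LabD)
qed

text \<open>Truth and falsity go through the induction together, since negation exchanges them and
  the triangle clauses refer to both. Injectivity of \<open>e\<close> lets valuations and relations
  be read back at labels.\<close>

lemma truth:
  assumes "inj e" and "w \<in> labels H" and "\<phi> \<in> S"
  shows "(sat_pos (term_model e) (e w) \<phi> \<longleftrightarrow> Lab w \<phi> VT \<in> H) \<and>
    (sat_neg (term_model e) (e w) \<phi> \<longleftrightarrow> Lab w \<phi> VF \<in> H)"
  using assms(2,3)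
proof (induction \<phi> arbitrary: w)
  case (Var p)
  then show ?case
    using \<open>inj e\<close> by (auto simp: term_model_def dest: injD)
next
  case (Neg \<phi>)
  have "\<phi> \<in> S"
    using subfms_closed[OF Neg.prems(2)] by auto
  then show ?case
    using Neg.IH Neg.prems by (simp add: Neg_iff)
next
  case (Conj \<phi> \<psi>)
  have "\<phi> \<in> S" "\<psi> \<in> S"
    using subfms_closed[OF Conj.prems(2)] by auto
  then show ?case
    using Conj.IH Conj.prems by (simp add: Conj_iff)
next
  case (Disj \<phi> \<psi>)
  have "\<phi> \<in> S" "\<psi> \<in> S"
    using subfms_closed[OF Disj.prems(2)] by auto
  then show ?case
    using Disj.IH Disj.prems by (simp add: Disj_iff)
next
  case (Tri \<phi>)
  have S: "\<phi> \<in> S"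
    using subfms_closed[OF Tri.prems(2)] by auto
  have rel: "(e w, x) \<in> rel (term_model e) \<longleftrightarrow> (\<exists>k. x = e k \<and> Rel w k \<in> H)" for x
    using \<open>inj e\<close> by (auto simp: term_model_def dest: injD)
  have succ: "(sat_pos (term_model e) (e k) \<phi> \<longleftrightarrow> Lab k \<phi> VT \<in> H)"
      "(sat_neg (term_model e) (e k) \<phi> \<longleftrightarrow> Lab k \<phi> VF \<in> H)" if "Rel w k \<in> H" for k
    using Tri.IH[of k] labels_RelD[OF that] S by blast+
  have "sat_pos (term_model e) (e w) (Tri \<phi>) \<longleftrightarrow> Lab w (Tri \<phi>) VT \<in> H"
    unfolding sat_pos.simps rel Tri_iff(1)[OF Tri.prems] using succ by blast
  moreover have "sat_neg (term_model e) (e w) (Tri \<phi>) \<longleftrightarrow> Lab w (Tri \<phi>) VF \<in> H"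
    unfolding sat_neg.simps rel Tri_iff(2)[OF Tri.prems] using succ by blast
  ultimately show ?case by blast
qed

end

section \<open>Extending finite irrefutable branches\<close>

definition extends :: "'p item set \<Rightarrow> 'p item set \<Rightarrow> bool" where
  "extends B B' \<longleftrightarrow> B \<subseteq> B' \<and> finite B' \<and> \<not> refutable B'"

text \<open>The contrapositive of \<open>refutable.rule\<close>: an irrefutable branch has an
  irrefutable result under every applicable rule.\<close>

lemma extends_rule:
  assumes "finite B" and "\<not> refutable B" and "rule_app B Ns" and "Ns \<noteq> []"
    and "\<And>N. N \<in> set Ns \<Longrightarrow> finite N"
  obtains B' N where "extends B B'" and "N \<in> set Ns" and "N \<subseteq> B'"
proof -
  obtain N where "N \<in> set Ns" "\<not> refutable (B \<union> N)"
    using assms refutable.rule by blast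
  then show thesis
    using that[of "B \<union> N" N] assms(1,5) unfolding extends_def by auto
qed

lemma extends_decide:
  assumes "finite B" and "\<not> refutable B" and "Lab u \<psi> v' \<in> B" and "\<phi> \<in> subfms \<psi>" and "w \<in> labels B"
  shows "\<exists>B'. extends B B' \<and> (Lab w \<phi> v \<in> B' \<or> Lab w \<phi> (bar v) \<in> B')"
  by (rule extends_rule[OF assms(1,2) rule_app.cut[OF assms(3-5), of v]]) auto

text \<open>Premises are read off \<open>B\<close> and witnesses off \<open>B'\<close>, so the
  property survives when \<open>B'\<close> grows while \<open>B\<close> stays fixed.\<close>

definition witnessed :: "label \<Rightarrow> 'p fm \<Rightarrow> 'p item set \<Rightarrow> 'p item set \<Rightarrow> bool" where
  "witnessed w \<phi> B B' \<longleftrightarrow>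
     (Lab w (Tri \<phi>) VF \<in> B \<and> Lab w (Tri \<phi>) VNT \<in> B \<longrightarrow>
        (\<exists>k l. Rel w k \<in> B' \<and> Rel w l \<in> B' \<and>
          (Lab k \<phi> VT \<in> B' \<and> Lab l \<phi> VNT \<in> B' \<or> Lab k \<phi> VF \<in> B' \<and> Lab l \<phi> VNF \<in> B'))) \<and>
     (Lab w (Tri \<phi>) VT \<in> B \<and> Lab w (Tri \<phi>) VF \<in> B \<longrightarrow>
        (\<exists>k. Rel w k \<in> B' \<and> Lab k \<phi> VT \<in> B' \<and> Lab k \<phi> VF \<in> B')) \<and>
     (Lab w (Tri \<phi>) VNT \<in> B \<and> Lab w (Tri \<phi>) VNF \<in> B \<longrightarrow>
        (\<exists>k. Rel w k \<in> B' \<and> Lab k \<phi> VNT \<in> B' \<and> Lab k \<phi> VNF \<in> B'))"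

text \<open>Any two of the three pairs of premises together contain a clash. An irrefutable
  \<open>B\<close> thus meets at most one of them, and one rule application suffices; if it meets
  none, \<open>B\<close> itself serves.\<close>

lemma extends_witnessed:
  assumes "finite B" and "\<not> refutable B"
  shows "\<exists>B'. extends B B' \<and> witnessed w \<phi> B B'"
proof -
  obtain k where k: "k \<notin> labels B"
    using ex_new_if_finite[OF infinite_UNIV_nat finite_labels[OF assms(1)]] by blast
  obtain l where l: "l \<notin> labels B" "k \<noteq> l"
    using ex_new_if_finite[OF infinite_UNIV_nat, of "insert k (labels B)"] finite_labels[OF assms(1)]
    by auto
  have clash: "\<not> (Lab w (Tri \<phi>) VT \<in> B \<and> Lab w (Tri \<phi>) VNT \<in> B)"
      "\<not> (Lab w (Tri \<phi>) VF \<in> B \<and> Lab w (Tri \<phi>) VNF \<in> B)"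
    using refutable_if_clash[of w "Tri \<phi>" VT B] refutable_if_clash[of w "Tri \<phi>" VF B] assms(2)
    by auto
  consider (F) "Lab w (Tri \<phi>) VF \<in> B" "Lab w (Tri \<phi>) VNT \<in> B"
    | (B) "Lab w (Tri \<phi>) VT \<in> B" "Lab w (Tri \<phi>) VF \<in> B"
    | (N) "Lab w (Tri \<phi>) VNT \<in> B" "Lab w (Tri \<phi>) VNF \<in> B"
    | (none) "witnessed w \<phi> B B"
    unfolding witnessed_def by blast
  then show ?thesis
  proof cases
    case F
    show ?thesis
      by (rule extends_rule[OF assms rule_app.tri_F[OF F k l]])
        (use F clash in \<open>auto simp: witnessed_def\<close>)
  next
    case B
    show ?thesis
      by (rule extends_rule[OF assms rule_app.tri_B_plus[OF B k]])
        (use B clash in \<open>auto simp: witnessed_def\<close>)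
  next
    case N
    show ?thesis
      by (rule extends_rule[OF assms rule_app.tri_N_plus[OF N k]])
        (use N clash in \<open>auto simp: witnessed_def\<close>)
  next
    case none
    then show ?thesis
      using assms unfolding extends_def by blast
  qed
qed

text \<open>Performs one scheduled task. Witnesses answer the values already in \<open>B\<close>;
  values first chosen by the cuts of this step are answered when the task returns.\<close>

lemma extends_step:
  assumes "finite B" and "\<not> refutable B" and "Lab u \<psi> v' \<in> B" and "\<phi> \<in> subfms \<psi>" and "w \<in> labels B"
  shows "\<exists>B'. extends B B' \<and> (\<forall>v. Lab w \<phi> v \<in> B' \<or> Lab w \<phi> (bar v) \<in> B') \<and>
    (\<forall>\<xi>. \<phi> = Tri \<xi> \<longrightarrow> witnessed w \<xi> B B')"
proof -
  have "\<exists>B1. extends B B1 \<and> (\<forall>\<xi>. \<phi> = Tri \<xi> \<longrightarrow> witnessed w \<xi> B B1)"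
  proof (cases \<phi>)
    case (Tri \<xi>)
    then show ?thesis
      using extends_witnessed[OF assms(1,2), of w \<xi>] by simp
  qed (use assms(1,2) in \<open>auto simp: extends_def\<close>)
  then obtain B1 where B1: "extends B B1" "\<forall>\<xi>. \<phi> = Tri \<xi> \<longrightarrow> witnessed w \<xi> B B1"
    by (elim exE conjE)
  have w1: "finite B1" "\<not> refutable B1" "Lab u \<psi> v' \<in> B1" "w \<in> labels B1"
    using B1(1) assms labels_mono[of B B1] unfolding extends_def by blast+
  obtain B2 where B2: "extends B1 B2" "Lab w \<phi> VT \<in> B2 \<or> Lab w \<phi> VNT \<in> B2"
    using extends_decide[OF w1(1-3) assms(4) w1(4), of VT] by auto
  have w2: "finite B2" "\<not> refutable B2" "Lab u \<psi> v' \<in> B2" "w \<in> labels B2"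
    using B2(1) w1 labels_mono[of B1 B2] unfolding extends_def by blast+
  obtain B3 where B3: "extends B2 B3" "Lab w \<phi> VF \<in> B3 \<or> Lab w \<phi> VNF \<in> B3"
    using extends_decide[OF w2(1-3) assms(4) w2(4), of VF] by auto
  have sub: "B \<subseteq> B1" "B1 \<subseteq> B2" "B2 \<subseteq> B3"
    using B1(1) B2(1) B3(1) unfolding extends_def by auto
  have "extends B B3"
    using B3(1) sub unfolding extends_def by blast
  \<comment> \<open>The four values form two pairs under \<open>bar\<close>, so the cuts on
    \<open>VT\<close> and \<open>VF\<close> cover them all.\<close>
  moreover have "Lab w \<phi> v \<in> B3 \<or> Lab w \<phi> (bar v) \<in> B3" for v
    using B2(2) B3(2) sub by (cases v) auto
  moreover have "witnessed w \<xi> B B3" if "\<phi> = Tri \<xi>" for \<xi>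
  proof -
    have "witnessed w \<xi> B B1" "B1 \<subseteq> B3"
      using B1(2) that sub by auto
    then show ?thesis
      unfolding witnessed_def by blast
  qed
  ultimately show ?thesis by blast
qed

section \<open>Construction of a Hintikka set by a fair schedule\<close>

instance fm :: (countable) countable
  by countable_datatype

text \<open>The union of a chain of finite irrefutable stages. Fixing the formulas as the
  subformulas of \<open>B0\<close> makes cut available on them at every stage, for any label present
  there.\<close>

lemma hintikka_extension:
  fixes B0 :: "('p :: countable) item set"
  assumes "finite B0" and "\<not> refutable B0"
  obtains H where "B0 \<subseteq> H" and "hintikka H {\<phi>. \<exists>u \<psi> v. Lab u \<psi> v \<in> B0 \<and> \<phi> \<in> subfms \<psi>}"
proof -
  define S where "S = {\<phi>. \<exists>u \<psi> v. Lab u \<psi> v \<in> B0 \<and> \<phi> \<in> subfms \<psi>}"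
  \<comment> \<open>Every pair of a label and a formula is scheduled infinitely often.\<close>
  define task :: "nat \<Rightarrow> label \<times> 'p fm" where "task n = from_nat (fst (prod_decode n))" for n
  have later: "\<exists>n \<ge> m. task n = (w, \<phi>)" for m w \<phi>
    \<comment> \<open>The second component is padding: it leaves the task unchanged and makes the
      index at least \<open>m\<close>.\<close>
    by (rule exI[of _ "prod_encode (to_nat (w, \<phi>), m)"])
      (simp add: task_def le_prod_encode_2)
  \<comment> \<open>A task may come up before its label exists; it then demands nothing, and the
    stage may stay as it is.\<close>
  define good where "good = (\<lambda>B w \<phi> B'. w \<in> labels B \<and> \<phi> \<in> S \<longrightarrow>
    (\<forall>v. Lab w \<phi> v \<in> B' \<or> Lab w \<phi> (bar v) \<in> B') \<and> (\<forall>\<xi>. \<phi> = Tri \<xi> \<longrightarrow> witnessed w \<xi> B B'))"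
  have "\<exists>C. \<forall>n. extends B0 (C n) \<and> (extends (C n) (C (Suc n)) \<and>
      good (C n) (fst (task n)) (snd (task n)) (C (Suc n)))"
  proof (rule dependent_nat_choice)
    show "\<exists>B. extends B0 B"
      using assms unfolding extends_def by blast
    fix B n
    assume B: "extends B0 B"
    have "\<exists>B'. extends B B' \<and> good B (fst (task n)) (snd (task n)) B'"
    proof (cases "fst (task n) \<in> labels B \<and> snd (task n) \<in> S")
      case True
      then obtain u \<psi> v where "Lab u \<psi> v \<in> B" "snd (task n) \<in> subfms \<psi>"
        using B unfolding S_def extends_def by auto
      then show ?thesis
        using extends_step[of B u \<psi> v "snd (task n)" "fst (task n)"] True B
        unfolding good_def extends_def by auto
    next
      case False
      then show ?thesis
        using B unfolding good_def extends_def by blast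
    qed
    then show "\<exists>B'. extends B0 B' \<and> (extends B B' \<and> good B (fst (task n)) (snd (task n)) B')"
      using B unfolding extends_def by (meson order_trans)
  qed
  then obtain C where C: "\<And>n. extends B0 (C n)" "\<And>n. extends (C n) (C (Suc n))"
      "\<And>n. good (C n) (fst (task n)) (snd (task n)) (C (Suc n))"
    by blast
  have mono: "C m \<subseteq> C n" if "m \<le> n" for m n
    using lift_Suc_mono_le[of C, OF _ that] C(2) unfolding extends_def by blast
  define H where "H = (\<Union>n. C n)"
  have sub: "C n \<subseteq> H" for n
    unfolding H_def by blast
  have stage: "\<exists>n. P \<subseteq> C n" if "finite P" "P \<subseteq> H" for P
    using that
  proof (induction P)
    case (insert x P)
    then obtain n m where "P \<subseteq> C n" "x \<in> C m"
      unfolding H_def by auto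
    then have "insert x P \<subseteq> C (max n m)"
      using mono[of n "max n m"] mono[of m "max n m"] by auto
    then show ?case ..
  qed simp
  \<comment> \<open>Here recurrence of tasks matters: the task has to come up after both the
    premises \<open>P\<close> and some item \<open>x\<close> carrying the label \<open>w\<close>
    have appeared.\<close>
  have scheduled: "\<exists>n. P \<subseteq> C n \<and> (\<forall>v. Lab w \<phi> v \<in> H \<or> Lab w \<phi> (bar v) \<in> H) \<and>
      (\<forall>\<xi>. \<phi> = Tri \<xi> \<longrightarrow> witnessed w \<xi> (C n) H)"
    if P: "finite P" "P \<subseteq> H" and w: "w \<in> labels H" and \<phi>: "\<phi> \<in> S" for P w \<phi>
  proof -
    obtain x where x: "x \<in> H" "w \<in> item_labels x"
      using w unfolding labels_def by blast
    obtain m where m: "insert x P \<subseteq> C m"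
      using stage[of "insert x P"] P x(1) by auto
    obtain n where n: "n \<ge> m" "task n = (w, \<phi>)"
      using later by blast
    have "insert x P \<subseteq> C n"
      using m mono[OF n(1)] by blast
    moreover from this have "w \<in> labels (C n)"
      using x(2) unfolding labels_def by blast
    ultimately have *: "P \<subseteq> C n" "\<forall>v. Lab w \<phi> v \<in> C (Suc n) \<or> Lab w \<phi> (bar v) \<in> C (Suc n)"
        "\<forall>\<xi>. \<phi> = Tri \<xi> \<longrightarrow> witnessed w \<xi> (C n) (C (Suc n))"
      using C(3)[of n] \<phi> n(2) unfolding good_def by auto
    have "witnessed w \<xi> (C n) H" if "\<phi> = Tri \<xi>" for \<xi>
    proof -
      have "witnessed w \<xi> (C n) (C (Suc n))"
        using *(3) that by blast
      then show ?thesis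
        unfolding witnessed_def using sub[of "Suc n"] by blast
    qed
    then show ?thesis
      using * sub[of "Suc n"] by blast
  qed
  have "hintikka H S"
  proof
    show "\<exists>B. P \<subseteq> B \<and> B \<subseteq> H \<and> \<not> refutable B" if "finite P" "P \<subseteq> H" for P
      using stage[OF that] C(1) sub unfolding extends_def by blast
    show "subfms \<phi> \<subseteq> S" if "\<phi> \<in> S" for \<phi>
      using that subfms_trans unfolding S_def by blast
    show "Lab w \<phi> v \<in> H \<or> Lab w \<phi> (bar v) \<in> H" if "w \<in> labels H" "\<phi> \<in> S" for w \<phi> v
      using scheduled[of "{}"] that by blast
    have wit: "\<exists>n. P \<subseteq> C n \<and> witnessed w \<phi> (C n) H"
      if "Tri \<phi> \<in> S" "finite P" "P \<subseteq> H" "Lab w \<psi> v \<in> P" for P w \<phi> \<psi> v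
      using scheduled[OF that(2,3) labels_LabD that(1)] that(3,4) by blast
    show "\<exists>k l. Rel w k \<in> H \<and> Rel w l \<in> H \<and>
        (Lab k \<phi> VT \<in> H \<and> Lab l \<phi> VNT \<in> H \<or> Lab k \<phi> VF \<in> H \<and> Lab l \<phi> VNF \<in> H)"
      if "Tri \<phi> \<in> S" "Lab w (Tri \<phi>) VF \<in> H" "Lab w (Tri \<phi>) VNT \<in> H" for \<phi> w
      using wit[OF that(1), of "{Lab w (Tri \<phi>) VF, Lab w (Tri \<phi>) VNT}" w "Tri \<phi>" VF] that
      unfolding witnessed_def by auto
    show "\<exists>k. Rel w k \<in> H \<and> Lab k \<phi> VT \<in> H \<and> Lab k \<phi> VF \<in> H"
      if "Tri \<phi> \<in> S" "Lab w (Tri \<phi>) VT \<in> H" "Lab w (Tri \<phi>) VF \<in> H" for \<phi> w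
      using wit[OF that(1), of "{Lab w (Tri \<phi>) VT, Lab w (Tri \<phi>) VF}" w "Tri \<phi>" VF] that
      unfolding witnessed_def by auto
    show "\<exists>k. Rel w k \<in> H \<and> Lab k \<phi> VNT \<in> H \<and> Lab k \<phi> VNF \<in> H"
      if "Tri \<phi> \<in> S" "Lab w (Tri \<phi>) VNT \<in> H" "Lab w (Tri \<phi>) VNF \<in> H" for \<phi> w
      using wit[OF that(1), of "{Lab w (Tri \<phi>) VNT, Lab w (Tri \<phi>) VNF}" w "Tri \<phi>" VNF] that
      unfolding witnessed_def by auto
  qed
  moreover have "B0 \<subseteq> H"
    using C(1) sub unfolding extends_def by blast
  ultimately show thesis
    using that unfolding S_def by blast
qed

section \<open>Completeness\<close>

theorem theorem3:
  fixes \<phi> \<chi> :: "('p :: countable) fm"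
  assumes "valid TYPE('w :: infinite) \<phi> \<chi>"
  shows "provable \<phi> \<chi>"
proof (rule ccontr)
  let ?B = "{Lab 0 \<phi> VT, Lab 0 \<chi> VNT}"
  let ?S = "{\<xi>. \<exists>u \<psi> v. Lab u \<psi> v \<in> ?B \<and> \<xi> \<in> subfms \<psi>}"
  assume "\<not> provable \<phi> \<chi>"
  then have "\<not> refutable ?B"
    using refutable_imp_provable by blast
  then obtain H where H: "?B \<subseteq> H" "hintikka H ?S"
    using hintikka_extension[of ?B] by blast
  then interpret hintikka H ?S by blast
  \<comment> \<open>Labels are natural numbers, so an infinite type of worlds has room for the
    countermodel.\<close>
  obtain e :: "label \<Rightarrow> 'w" where e: "inj e"
    using infinite_countable_subset[OF infinite_UNIV] by blast
  have zero: "0 \<in> labels H"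
    using H(1) labels_LabD[of 0 \<phi> VT H] by blast
  have S: "\<phi> \<in> ?S" "\<chi> \<in> ?S"
    using subfms_refl by blast+
  have "sat_pos (term_model e) (e 0) \<phi>"
    using truth[OF e zero S(1)] H(1) by blast
  moreover have "\<not> sat_pos (term_model e) (e 0) \<chi>"
    using truth[OF e zero S(2)] VNT_iff[OF zero S(2)] H(1) by blast
  moreover have "is_model (term_model e)"
    using is_model_term_model H(1) by blast
  moreover have "e 0 \<in> worlds (term_model e)"
    using zero by (simp add: term_model_def)
  ultimately show False
    using assms unfolding valid_def by blast
qed

end
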